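(* Let $x^\dagger$ be a solution of $\min_x\frac12\|F(x)-y\|^2$. Let $e_k=x^\dagger-x_k^\delta$ and $x_{k+1}^\delta=x_k^\delta+p_k$, where $p_k=p(\lambda_k)$ is the step defined in the context, with $\lambda_k>0$. Assume that there exists $\theta_k>1$ such that $$\|Q_{\ell_k}^Tm_k(e_k)\|\le\frac1{\theta_k}\|Q_{\ell_k}^Tm_k(p_k)\|.$$ Then $$\|x_{k+1}^\delta-x^\dagger\|^2-\|x_k^\delta-x^\dagger\|^2\le\frac{2}{\lambda_k}\left(\frac1{\theta_k}-1\right)\|Q_{\ell_k}^Tm_k(p_k)\|^2+\frac{2}{\lambda_k}\|Q_{\ell_k}^Tm_k(p_k)\|\,\|Q_{\ell_k}T_{\ell_k}^TT_{\ell_k}Q_{\ell_k}^T-Q_{\ell_k}Q_{\ell_k}^TB_k\|\,\|x_k^\delta-x^\dagger\|.$$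
   Context: $F:\mathcal{D}(F)\subseteq\mathbb{R}^n\to\mathbb{R}^m$, $m\ge n$, is continuously differentiable with Jacobian $J$; $y,y^\delta\in\mathbb{R}^m$ with $\|y-y^\delta\|\le\delta$, $\delta\ge0$; $\|\cdot\|$ is the 2-norm. At $x_k^\delta$ set $B_k=J(x_k^\delta)^TJ(x_k^\delta)$, $g_k=J(x_k^\delta)^T(F(x_k^\delta)-y^\delta)\neq0$, $m_k(p)=B_kp+g_k$. For $1\le\ell_k\le n$, $Q_{\ell_k},T_{\ell_k}$ are the output of $\ell=\ell_k$ steps of Golub-Kahan-Lanczos bidiagonalization with $A=J(x_k^\delta)$: $q_1=g_k/\|g_k\|$, $\beta_0=0$, and for $j=1,\dots,\ell$: $\tilde p_j=Aq_j-\beta_{j-1}p_{j-1}$, $\alpha_j=\|\tilde p_j\|$, $p_j=\tilde p_j/\alpha_j$, $\tilde q_{j+1}=A^Tp_j-\alpha_jq_j$, $\beta_j=\|\tilde q_{j+1}\|$, $q_{j+1}=\tilde q_{j+1}/\beta_j$ (these vectors $p_j$ are unrelated to the step $p_k$). Here $Q_{\ell}=[q_1,\dots,q_\ell]\in\mathbb{R}^{n\times\ell}$ has orthonormal columns, and $T_\ell\in\mathbb{R}^{\ell\times\ell}$ is upper bidiagonal with diagonal $\alpha_1,\dots,\alpha_\ell$ and superdiagonal $\beta_1,\dots,\beta_{\ell-1}$. It is assumed that the process is not prematurely halted ($\alpha_j\neq0$ for $j\le\ell$, $\beta_j\ne0$ for $j<\ell$). For $\lambda\ge0$, $w(\lambda)\in\mathbb{R}^{\ell_k}$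 solves $[(T_{\ell_k}^TT_{\ell_k})^2+\lambda I]w(\lambda)=-(T_{\ell_k}^TT_{\ell_k})^{1/2}Q_{\ell_k}^Tg_k$, where $Q_{\ell_k}^Tg_k=\|g_k\|e_1$ (here $e_1$ is the first canonical basis vector); $z(\lambda)=Q_{\ell_k}w(\lambda)$ and $p(\lambda)=Q_{\ell_k}(T_{\ell_k}^TT_{\ell_k})^{1/2}Q_{\ell_k}^Tz(\lambda)$. In the method, $\lambda_k$ is the multiplier of the trust-region constraint, i.e. $\lambda_k\geq 0$, $\lambda_k(\Delta_k-\|w(\lambda_k)\|)=0$, $\|w(\lambda_k)\|\le\Delta_k$ for the trust-region radius $\Delta_k>0$. *)

theory Defs
  imports "HOL-Analysis.Analysis"
begin

text \<open>
  Golub-Kahan-Lanczos bidiagonalization of \<open>A\<close>, \<open>l\<close> steps, started at \<open>g / \<parallel>g\<parallel>\<close>. The sequences are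
  indexed from 1 as in the recurrence; \<open>p 0\<close> is unconstrained, as it is only ever multiplied by
  \<open>\<beta> 0 = 0\<close>. If the process breaks down, the divisions follow the convention \<open>x / 0 = 0\<close>; that
  it does not break down is a separate condition (the second definition), under which
  \<open>q 1, \<dots>, q l\<close>, \<open>\<alpha> 1, \<dots>, \<alpha> l\<close> and \<open>\<beta> 1, \<dots>, \<beta> (l - 1)\<close> involve no division by zero.
\<close>

definition gkl_bidiagonalization ::
  "real^'n^'m \<Rightarrow> real^'n \<Rightarrow> nat \<Rightarrow> (nat \<Rightarrow> real^'n) \<Rightarrow> (nat \<Rightarrow> real^'m) \<Rightarrow>
    (nat \<Rightarrow> real) \<Rightarrow> (nat \<Rightarrow> real) \<Rightarrow> bool"
  where "gkl_bidiagonalization A g l q p \<alpha> \<beta> \<longleftrightarrow>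
    q 1 = (1 / norm g) *\<^sub>R g \<and> \<beta> 0 = 0 \<and>
    (\<forall>j\<in>{1..l}.
       (let p' = A *v q j - \<beta> (j - 1) *\<^sub>R p (j - 1);
            q' = transpose A *v p j - \<alpha> j *\<^sub>R q j
        in \<alpha> j = norm p' \<and> p j = (1 / \<alpha> j) *\<^sub>R p' \<and>
           \<beta> j = norm q' \<and> q (j + 1) = (1 / \<beta> j) *\<^sub>R q'))"

definition gkl_not_halted :: "nat \<Rightarrow> (nat \<Rightarrow> real) \<Rightarrow> (nat \<Rightarrow> real) \<Rightarrow> bool"
  where "gkl_not_halted l \<alpha> \<beta> \<longleftrightarrow> (\<forall>j\<in>{1..l}. \<alpha> j \<noteq> 0) \<and> (\<forall>j\<in>{1..<l}. \<beta> j \<noteq> 0)"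

text \<open>
  The number of steps is the cardinality of a linearly ordered finite index type \<open>'l\<close>, whose
  elements are numbered \<open>1, \<dots>, CARD('l)\<close> in increasing order.
\<close>

definition index_pos :: "'l::{finite,linorder} \<Rightarrow> nat"
  where "index_pos i = card {..i}"

definition gkl_Q :: "(nat \<Rightarrow> real^'n) \<Rightarrow> real^('l::{finite,linorder})^'n"
  where "gkl_Q q = (\<chi> r c. q (index_pos c) $ r)"

definition gkl_T ::
  "(nat \<Rightarrow> real) \<Rightarrow> (nat \<Rightarrow> real) \<Rightarrow> real^('l::{finite,linorder})^('l::{finite,linorder})"
  where "gkl_T \<alpha> \<beta> =
    (\<chi> i j. if index_pos j = index_pos i then \<alpha> (index_pos i)
            else if index_pos j = index_pos i + 1 then \<beta> (index_pos i)
            else 0)"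

definition psd_matrix :: "real^'n^'n \<Rightarrow> bool"
  where "psd_matrix S \<longleftrightarrow> transpose S = S \<and> (\<forall>v. 0 \<le> v \<bullet> (S *v v))"

text \<open>The principal square root; it exists uniquely when \<open>M\<close> is positive semidefinite.\<close>

definition matrix_sqrt :: "real^'n^'n \<Rightarrow> real^'n^'n"
  where "matrix_sqrt M = (THE S. psd_matrix S \<and> S ** S = M)"

text \<open>
  \<open>step_w Q T g lam\<close> is the solution \<open>w(lam)\<close> of the regularized system; it is unique for \<open>lam > 0\<close>, and
  also for \<open>lam = 0\<close> if the diagonal of the bidiagonal \<open>T\<close> has no zero.
\<close>

definition step_w ::
  "real^'l^'n \<Rightarrow> real^'l^'l \<Rightarrow> real^'n \<Rightarrow> real \<Rightarrow> real^'l"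
  where "step_w Q T g lam =
    (THE w. ((transpose T ** T) ** (transpose T ** T) + lam *\<^sub>R mat 1) *v w =
            - (matrix_sqrt (transpose T ** T) *v (transpose Q *v g)))"

definition step_z ::
  "real^'l^'n \<Rightarrow> real^'l^'l \<Rightarrow> real^'n \<Rightarrow> real \<Rightarrow> real^'n"
  where "step_z Q T g lam = Q *v step_w Q T g lam"

definition step_p ::
  "real^'l^'n \<Rightarrow> real^'l^'l \<Rightarrow> real^'n \<Rightarrow> real \<Rightarrow> real^'n"
  where "step_p Q T g lam =
    (Q ** matrix_sqrt (transpose T ** T) ** transpose Q) *v step_z Q T g lam"

text \<open>
  The matrix 2-norm. The type class \<^const>\<open>norm\<close> on \<open>real^'n^'m\<close> is the Frobenius norm instead.
\<close>

definition matrix_norm2 :: "real^'n^'m \<Rightarrow> real"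
  where "matrix_norm2 A = onorm (\<lambda>v. A *v v)"

end

theory Submission
  imports Defs
begin

text \<open>
  Write \<open>M = T\<^sup>T T\<close>, \<open>S = M\<^bsup>1/2\<^esup>\<close>, \<open>c = Q\<^sup>T g\<close> and \<open>r = Q\<^sup>T m(p)\<close>. Two facts about the bidiagonalization
  are used: \<open>Q\<^sup>T Q = I\<close> and \<open>Q\<^sup>T B Q = M\<close> (\<open>gkl_Q_orthonormal\<close>, \<open>gkl_gram_projection\<close>). The first
  shows that the step is \<open>p = Q u\<close> with \<open>u = S w\<close>; multiplying the equation for \<open>w\<close> by \<open>S\<close>
  removes the square root and leaves \<open>(M\<^sup>2 + \<lambda>) u = - M c\<close>. The second gives \<open>r = M u + c\<close>, so the
  equation for \<open>u\<close> says that \<open>\<lambda> u = - M r\<close>: the step is a scaled gradient step for the projected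
  model (\<open>regularized_step_residual\<close>).

  For the error \<open>e\<close> this yields \<open>\<parallel>p - e\<parallel>\<^sup>2 - \<parallel>e\<parallel>\<^sup>2 = \<parallel>p\<parallel>\<^sup>2 + (2/\<lambda>) r \<bullet> M Q\<^sup>T e\<close>. The vector \<open>M Q\<^sup>T e\<close>
  differs from \<open>Q\<^sup>T B e\<close> by \<open>Q\<^sup>T E e\<close>, where \<open>E = Q M Q\<^sup>T - Q Q\<^sup>T B\<close>, and
  \<open>Q\<^sup>T B e = Q\<^sup>T m(e) - c = Q\<^sup>T m(e) - r + M u\<close>. The last term contributes
  \<open>(2/\<lambda>) r \<bullet> M u = -2 \<parallel>u\<parallel>\<^sup>2 = -2 \<parallel>p\<parallel>\<^sup>2\<close>, which absorbs the \<open>\<parallel>p\<parallel>\<^sup>2\<close>; the remaining terms are bounded by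
  the Cauchy-Schwarz inequality and the hypothesis on \<open>\<parallel>Q\<^sup>T m(e)\<parallel>\<close> (\<open>regularized_step_error_decrease\<close>).

  The square root and the vector \<open>w\<close> are given by definite descriptions, so both must be shown to
  exist uniquely. For \<open>w\<close> this is the invertibility of \<open>M\<^sup>2 + \<lambda> I\<close>; for \<open>S\<close> it is an orthonormal
  basis of eigenvectors of a symmetric matrix.
\<close>

section \<open>An orthonormal eigenbasis of a symmetric matrix\<close>

lemma inner_matrix_transpose:
  fixes A :: "real^'n^'m"
  shows "x \<bullet> (A *v y) = (transpose A *v x) \<bullet> y"
  by (simp add: dot_lmul_matrix)

text \<open>Products with a transpose are kept in the form to which the preceding lemma applies.\<close>

declare transpose_matrix_vector [simp del]

text \<open>
  A maximizer \<open>v\<close> of the Rayleigh quotient over the unit sphere of the subspace is an eigenvector: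
  with \<open>\<mu>\<close> the maximum, the quadratic form \<open>N x = \<mu> \<parallel>x\<parallel>\<^sup>2 - x \<bullet> A x\<close> is nonnegative on the
  subspace and vanishes at \<open>v\<close>, so its derivative at \<open>v\<close> vanishes in every direction of the subspace.
\<close>

lemma symmetric_matrix_eigenvector_in_subspace:
  fixes A :: "real^'n^'n"
  assumes sym: "transpose A = A" and U: "subspace U" "U \<noteq> {0}"
    and inv: "\<And>x. x \<in> U \<Longrightarrow> A *v x \<in> U"
  obtains v \<mu> where "v \<in> U" "norm v = 1" "A *v v = \<mu> *\<^sub>R v"
proof -
  let ?K = "U \<inter> sphere 0 1"
  obtain a where a: "a \<in> U" "a \<noteq> 0"
    using U subspace_0 by blast
  have "(1 / norm a) *\<^sub>R a \<in> ?K"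
    using a U by (simp add: subspace_scale)
  then have ne: "?K \<noteq> {}" by blast
  have cpt: "compact ?K"
    by (intro closed_Int_compact closed_subspace U compact_sphere)
  have "continuous_on ?K (\<lambda>x. x \<bullet> (A *v x))"
    by (intro continuous_intros linear_continuous_on linear_conv_bounded_linear[THEN iffD1]
        matrix_vector_mul_linear)
  from continuous_attains_sup[OF cpt ne this]
  obtain v where v: "v \<in> ?K" and max: "\<And>x. x \<in> ?K \<Longrightarrow> x \<bullet> (A *v x) \<le> v \<bullet> (A *v v)"
    by blast
  define \<mu> where "\<mu> = v \<bullet> (A *v v)"
  define N where "N x = \<mu> * (x \<bullet> x) - x \<bullet> (A *v x)" for x
  have vU: "v \<in> U" and v1: "norm v = 1" using v by auto
  have vv: "v \<bullet> v = 1" using v1 by (simp add: norm_eq_1)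
  have N_nonneg: "N x \<ge> 0" if "x \<in> U" for x
  proof (cases "x = 0")
    case False
    have "(1 / norm x) *\<^sub>R x \<in> ?K"
      using that False U by (simp add: subspace_scale)
    from max[OF this] have "(x \<bullet> (A *v x)) / (norm x)^2 \<le> \<mu>"
      by (simp add: \<mu>_def matrix_vector_mult_scaleR power2_eq_square)
    then show ?thesis
      using False by (simp add: N_def divide_le_eq power2_norm_eq_inner)
  qed (simp add: N_def)
  define w where "w = A *v v - \<mu> *\<^sub>R v"
  have wU: "w \<in> U"
    unfolding w_def using vU inv U by (intro subspace_diff subspace_scale) auto
  have Avw: "A *v v = w + \<mu> *\<^sub>R v" by (simp add: w_def)
  have "v \<bullet> w = 0"
    by (simp add: w_def inner_diff_right vv \<mu>_def)
  then have wv: "w \<bullet> v = 0" by (simp add: inner_commute)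
  have vAw: "v \<bullet> (A *v w) = w \<bullet> w"
    by (simp add: inner_matrix_transpose[of v A] sym Avw inner_add_left inner_commute[of v w] wv)
  have N_line: "N (v + t *\<^sub>R w) = t^2 * N w - 2 * t * (w \<bullet> w)" for t
    unfolding N_def
    by (simp add: matrix_vector_right_distrib matrix_vector_mult_scaleR inner_add_left
        inner_add_right vv vAw Avw wv inner_commute[of v w] algebra_simps power2_eq_square)
  have N_pos: "N (v + t *\<^sub>R w) \<ge> 0" for t
    using N_nonneg vU wU U by (simp add: subspace_add subspace_scale)
  have "w \<bullet> w = 0"
  proof (cases "N w = 0")
    case True
    then have "N (v + 1 *\<^sub>R w) = - 2 * (w \<bullet> w)" by (simp only: N_line)
    then show ?thesis using N_pos[of 1] inner_ge_zero[of w] by linarith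
  next
    case False
    then have pos: "N w > 0" using N_nonneg[OF wU] by linarith
    \<comment> \<open>The value of \<open>t\<close> that minimizes the quadratic polynomial \<open>N (v + t w)\<close>.\<close>
    have "N (v + ((w \<bullet> w) / N w) *\<^sub>R w) = - ((w \<bullet> w)^2 / N w)"
      using pos by (simp add: N_line field_simps power2_eq_square)
    with N_pos[of "(w \<bullet> w) / N w"] have "(w \<bullet> w)^2 / N w \<le> 0" by linarith
    then have "(w \<bullet> w)^2 \<le> 0" using pos by (simp add: divide_le_0_iff)
    then show ?thesis by simp
  qed
  then have "A *v v = \<mu> *\<^sub>R v" by (simp add: Avw)
  with vU v1 that show ?thesis by blast
qed

text \<open>
  An orthonormal set of eigenvectors of the largest possible size is a basis: otherwise the
  orthogonal complement, which is invariant under a symmetric matrix, contains a further eigenvector.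
\<close>

lemma symmetric_matrix_orthonormal_eigenbasis:
  fixes A :: "real^'n^'n"
  assumes sym: "transpose A = A"
  obtains E \<mu> where "finite E" "\<And>b. b \<in> E \<Longrightarrow> A *v b = \<mu> b *\<^sub>R b"
    "\<And>b c. b \<in> E \<Longrightarrow> c \<in> E \<Longrightarrow> b \<bullet> c = (if b = c then 1 else 0)"
    "\<And>x. x = (\<Sum>b\<in>E. (x \<bullet> b) *\<^sub>R b)"
proof -
  define P where "P E \<longleftrightarrow> pairwise orthogonal E \<and>
    (\<forall>b\<in>E. norm b = 1 \<and> (\<exists>\<mu>. A *v b = \<mu> *\<^sub>R b))" for E
  have bound: "finite E \<and> card E < Suc CARD('n)" if "P E" for E
  proof -
    have "0 \<notin> E" using that by (auto simp: P_def)
    then have "independent E"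
      using that by (simp add: P_def pairwise_orthogonal_independent)
    from independent_bound[OF this] show ?thesis by simp
  qed
  have "P {}" by (simp add: P_def)
  then obtain E where E: "P E" and max: "\<And>E'. P E' \<Longrightarrow> card E' \<le> card E"
    using ex_has_greatest_nat[of P "{}" card "Suc CARD('n)"] bound by blast
  have fin: "finite E" using bound E by blast
  obtain \<mu> where \<mu>: "\<And>b. b \<in> E \<Longrightarrow> A *v b = \<mu> b *\<^sub>R b"
    using E unfolding P_def by metis
  have on: "b \<bullet> c = (if b = c then 1 else 0)" if "b \<in> E" "c \<in> E" for b c
    using E that by (auto simp: P_def pairwise_def orthogonal_def norm_eq_1)
  define U where "U = {x. \<forall>b\<in>E. x \<bullet> b = 0}"
  have subU: "subspace U"
    by (auto simp: U_def subspace_def inner_add_left)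
  have invU: "A *v x \<in> U" if "x \<in> U" for x
  proof -
    have "(A *v x) \<bullet> b = 0" if "b \<in> E" for b
    proof -
      have "(A *v x) \<bullet> b = x \<bullet> (A *v b)" by (simp add: inner_matrix_transpose sym)
      then show ?thesis using \<open>x \<in> U\<close> that by (simp add: \<mu> U_def)
    qed
    then show ?thesis by (simp add: U_def)
  qed
  have "U = {0}"
  proof (rule ccontr)
    assume "U \<noteq> {0}"
    from symmetric_matrix_eigenvector_in_subspace[OF sym subU this invU]
    obtain v \<nu> where v: "v \<in> U" "norm v = 1" "A *v v = \<nu> *\<^sub>R v" by blast
    have "v \<notin> E" using v by (auto simp: U_def norm_eq_1)
    moreover have "P (insert v E)"
      using E v by (auto simp: P_def pairwise_insert orthogonal_def U_def inner_commute)
    ultimately show False using max[of "insert v E"] fin by simp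
  qed
  have expand: "x = (\<Sum>b\<in>E. (x \<bullet> b) *\<^sub>R b)" for x
  proof -
    have "(x - (\<Sum>b\<in>E. (x \<bullet> b) *\<^sub>R b)) \<bullet> c = 0" if "c \<in> E" for c
    proof -
      have "(\<Sum>b\<in>E. (x \<bullet> b) *\<^sub>R b) \<bullet> c = (\<Sum>b\<in>E. if b = c then x \<bullet> c else 0)"
        unfolding inner_sum_left using on[OF _ that] by (intro sum.cong) auto
      then show ?thesis using fin that by (simp add: inner_diff_left)
    qed
    then have "x - (\<Sum>b\<in>E. (x \<bullet> b) *\<^sub>R b) \<in> U" by (simp add: U_def)
    then show ?thesis using \<open>U = {0}\<close> by simp
  qed
  show thesis using that[OF fin \<mu> on expand] .
qed

section \<open>The principal square root\<close>

text \<open>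
  The reason for uniqueness of the square root: \<open>(R + \<surd>\<mu> I) (R - \<surd>\<mu> I) b = 0\<close>, and \<open>R + \<surd>\<mu> I\<close> is
  injective if \<open>\<mu> > 0\<close>. For \<open>\<mu> = 0\<close> symmetry gives \<open>\<parallel>R b\<parallel>\<^sup>2 = b \<bullet> R\<^sup>2 b = 0\<close>.
\<close>

lemma psd_sqrt_eigenvector:
  fixes R :: "real^'n^'n"
  assumes R: "psd_matrix R" and eig: "(R ** R) *v b = \<mu> *\<^sub>R b" and "0 \<le> \<mu>"
  shows "R *v b = sqrt \<mu> *\<^sub>R b"
proof (cases "\<mu> = 0")
  case True
  have "(R *v b) \<bullet> (R *v b) = b \<bullet> ((R ** R) *v b)"
    using R by (simp add: psd_matrix_def inner_matrix_transpose[of b R] matrix_vector_mul_assoc[symmetric])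
  then show ?thesis using True eig by simp
next
  case False
  define d where "d = R *v b - sqrt \<mu> *\<^sub>R b"
  have "R *v d + sqrt \<mu> *\<^sub>R d = 0"
    using eig \<open>0 \<le> \<mu>\<close>
    by (simp add: d_def matrix_vector_mult_diff_distrib matrix_vector_mult_scaleR
        matrix_vector_mul_assoc scaleR_diff_right)
  then have "d \<bullet> (R *v d) + sqrt \<mu> * (d \<bullet> d) = 0"
    by (metis inner_add_right inner_scaleR_right inner_zero_right)
  moreover have "0 \<le> d \<bullet> (R *v d)" using R by (simp add: psd_matrix_def)
  moreover have "0 \<le> sqrt \<mu> * (d \<bullet> d)" using \<open>0 \<le> \<mu>\<close> by simp
  ultimately have "sqrt \<mu> * (d \<bullet> d) = 0" by linarith
  then have "d = 0" using False by simp
  then show ?thesis by (simp add: d_def)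
qed

text \<open>The root is \<open>x \<mapsto> \<Sum>b\<in>E. \<surd>\<mu>\<^sub>b (x \<bullet> b) b\<close> for an orthonormal eigenbasis \<open>E\<close> of \<open>M\<close>.\<close>

lemma psd_matrix_sqrt_exists:
  fixes M :: "real^'n^'n"
  assumes M: "psd_matrix M"
  shows "\<exists>S. psd_matrix S \<and> S ** S = M"
proof -
  have sym: "transpose M = M" using M by (simp add: psd_matrix_def)
  obtain E \<mu> where fin: "finite E" and eig: "\<And>b. b \<in> E \<Longrightarrow> M *v b = \<mu> b *\<^sub>R b"
    and on: "\<And>b c. b \<in> E \<Longrightarrow> c \<in> E \<Longrightarrow> b \<bullet> c = (if b = c then 1 else 0)"
    and expand: "\<And>x. x = (\<Sum>b\<in>E. (x \<bullet> b) *\<^sub>R b)"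
    using symmetric_matrix_orthonormal_eigenbasis[OF sym] by blast
  have nonneg: "0 \<le> \<mu> b" if "b \<in> E" for b
  proof -
    have "b \<bullet> (M *v b) = \<mu> b" using that by (simp add: eig on)
    then show ?thesis using M by (metis psd_matrix_def)
  qed
  define f where "f x = (\<Sum>b\<in>E. (sqrt (\<mu> b) * (x \<bullet> b)) *\<^sub>R b)" for x
  have lin: "linear f"
    unfolding f_def
    by (intro linearI) (simp_all add: inner_add_left algebra_simps sum.distrib scaleR_sum_right)
  define S where "S = matrix f"
  have Sv: "S *v x = f x" for x
    unfolding S_def by (simp add: matrix_works lin)
  have inner_f: "y \<bullet> f x = (\<Sum>b\<in>E. sqrt (\<mu> b) * (x \<bullet> b) * (y \<bullet> b))" for x y
    by (simp add: f_def inner_sum_right)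
  have "x \<bullet> (transpose S *v y) = x \<bullet> (S *v y)" for x y
  proof -
    have "x \<bullet> (transpose S *v y) = y \<bullet> f x"
      by (simp add: inner_matrix_transpose[of x "transpose S"] Sv inner_commute)
    also have "\<dots> = x \<bullet> f y" unfolding inner_f by (simp add: mult_ac)
    finally show ?thesis by (simp add: Sv)
  qed
  then have "transpose S *v y = S *v y" for y
    using vector_eq_ldot[of "transpose S *v y" "S *v y"] by blast
  then have Ssym: "transpose S = S" by (simp add: matrix_eq)
  have Spos: "0 \<le> v \<bullet> (S *v v)" for v
    unfolding Sv inner_f using nonneg by (intro sum_nonneg) (simp add: mult.assoc)
  have f_eig: "f b = sqrt (\<mu> b) *\<^sub>R b" if "b \<in> E" for b
  proof -
    have "f b = (\<Sum>c\<in>E. if c = b then sqrt (\<mu> b) *\<^sub>R b else 0)"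
      unfolding f_def by (intro sum.cong) (auto simp: on that)
    then show ?thesis using fin that by simp
  qed
  have "(S ** S) *v x = M *v x" for x
  proof -
    have "(S ** S) *v b = M *v b" if "b \<in> E" for b
      using that nonneg[OF that]
      by (simp add: matrix_vector_mul_assoc[symmetric] Sv f_eig linear_scale[OF lin] eig)
    then have "(S ** S) *v (\<Sum>b\<in>E. (x \<bullet> b) *\<^sub>R b) = M *v (\<Sum>b\<in>E. (x \<bullet> b) *\<^sub>R b)"
      by (simp add: linear_sum[OF matrix_vector_mul_linear] matrix_vector_mult_scaleR)
    then show ?thesis by (simp only: expand[symmetric])
  qed
  then have "S ** S = M" by (simp add: matrix_eq)
  then show ?thesis using Ssym Spos by (auto simp: psd_matrix_def)
qed

text \<open>Both roots are determined on an eigenbasis of their common square.\<close>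

lemma psd_matrix_sqrt_unique:
  fixes R S :: "real^'n^'n"
  assumes R: "psd_matrix R" and S: "psd_matrix S" and eq: "R ** R = S ** S"
  shows "R = S"
proof -
  have sym: "transpose (S ** S) = S ** S"
    using S by (simp add: psd_matrix_def matrix_transpose_mul)
  have inner_SS: "x \<bullet> ((S ** S) *v x) = (S *v x) \<bullet> (S *v x)" for x
    using S by (simp add: psd_matrix_def inner_matrix_transpose[of x S] matrix_vector_mul_assoc[symmetric])
  obtain E \<mu> where "finite E" and eig: "\<And>b. b \<in> E \<Longrightarrow> (S ** S) *v b = \<mu> b *\<^sub>R b"
    and on: "\<And>b c. b \<in> E \<Longrightarrow> c \<in> E \<Longrightarrow> b \<bullet> c = (if b = c then 1 else 0)"
    and expand: "\<And>x. x = (\<Sum>b\<in>E. (x \<bullet> b) *\<^sub>R b)"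
    using symmetric_matrix_orthonormal_eigenbasis[OF sym] by blast
  have same: "R *v b = S *v b" if "b \<in> E" for b
  proof -
    have "\<mu> b = (S *v b) \<bullet> (S *v b)"
      using inner_SS[of b] that by (simp add: eig on)
    then have "0 \<le> \<mu> b" by simp
    moreover have "(R ** R) *v b = \<mu> b *\<^sub>R b"
      using eig[OF that] by (simp only: eq)
    ultimately show ?thesis
      using psd_sqrt_eigenvector[OF R] psd_sqrt_eigenvector[OF S eig[OF that]] by simp
  qed
  have "R *v x = S *v x" for x
  proof -
    have "R *v (\<Sum>b\<in>E. (x \<bullet> b) *\<^sub>R b) = S *v (\<Sum>b\<in>E. (x \<bullet> b) *\<^sub>R b)"
      by (simp add: linear_sum[OF matrix_vector_mul_linear] matrix_vector_mult_scaleR same)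
    then show ?thesis by (simp only: expand[symmetric])
  qed
  then show ?thesis by (simp add: matrix_eq)
qed

lemma matrix_sqrt_properties:
  fixes M :: "real^'n^'n"
  assumes "psd_matrix M"
  shows "psd_matrix (matrix_sqrt M)" "matrix_sqrt M ** matrix_sqrt M = M"
proof -
  have "\<exists>!S. psd_matrix S \<and> S ** S = M"
    using psd_matrix_sqrt_exists[OF assms] psd_matrix_sqrt_unique by metis
  from theI'[OF this] show "psd_matrix (matrix_sqrt M)" "matrix_sqrt M ** matrix_sqrt M = M"
    by (simp_all add: matrix_sqrt_def)
qed

lemma psd_matrix_gram:
  fixes A :: "real^'n^'m"
  shows "psd_matrix (transpose A ** A)"
proof -
  have "v \<bullet> ((transpose A ** A) *v v) = (A *v v) \<bullet> (A *v v)" for v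
    by (simp only: matrix_vector_mul_assoc[symmetric] inner_matrix_transpose transpose_transpose)
  then show ?thesis
    by (simp add: psd_matrix_def matrix_transpose_mul)
qed

section \<open>Golub-Kahan-Lanczos bidiagonalization\<close>

text \<open>
  The recurrence, solved for \<open>A q\<^sub>j\<close> and \<open>A\<^sup>T p\<^sub>j\<close>. Both equations survive a breakdown: if
  \<open>\<alpha> j\<close> or \<open>\<beta> j\<close> is zero, then so is the vector that is to be normalized.
\<close>

lemma gkl_recurrence:
  assumes "gkl_bidiagonalization A g l q p \<alpha> \<beta>" and "j \<in> {1..l}"
  shows "A *v q j = \<beta> (j - 1) *\<^sub>R p (j - 1) + \<alpha> j *\<^sub>R p j"
    and "transpose A *v p j = \<alpha> j *\<^sub>R q j + \<beta> j *\<^sub>R q (j + 1)"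
    and "\<alpha> j \<noteq> 0 \<Longrightarrow> norm (p j) = 1"
    and "\<beta> j \<noteq> 0 \<Longrightarrow> norm (q (j + 1)) = 1"
proof -
  let ?p = "A *v q j - \<beta> (j - 1) *\<^sub>R p (j - 1)"
  let ?q = "transpose A *v p j - \<alpha> j *\<^sub>R q j"
  have *: "\<alpha> j = norm ?p" "p j = (1 / \<alpha> j) *\<^sub>R ?p" "\<beta> j = norm ?q" "q (j + 1) = (1 / \<beta> j) *\<^sub>R ?q"
    using assms by (auto simp: gkl_bidiagonalization_def Let_def)
  have "\<alpha> j *\<^sub>R p j = ?p"
    by (subst *(2)) (use *(1) in auto)
  then show "A *v q j = \<beta> (j - 1) *\<^sub>R p (j - 1) + \<alpha> j *\<^sub>R p j"
    by (simp add: algebra_simps)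
  have "\<beta> j *\<^sub>R q (j + 1) = ?q"
    by (subst *(4)) (use *(3) in auto)
  then show "transpose A *v p j = \<alpha> j *\<^sub>R q j + \<beta> j *\<^sub>R q (j + 1)"
    by (simp add: algebra_simps)
  show "norm (p j) = 1" if "\<alpha> j \<noteq> 0"
    by (subst *(2)) (use *(1) that in auto)
  show "norm (q (j + 1)) = 1" if "\<beta> j \<noteq> 0"
    by (subst *(4)) (use *(3) that in auto)
qed

text \<open>
  Orthogonalizing against the immediate predecessor is enough, as in the Lanczos process: the inner
  product \<open>\<beta>\<^sub>k q\<^sub>k\<^sub>+\<^sub>1 \<bullet> q\<^sub>i\<close> equals \<open>p\<^sub>k \<bullet> A q\<^sub>i - \<alpha>\<^sub>k q\<^sub>k \<bullet> q\<^sub>i\<close>, and \<open>A q\<^sub>i\<close> lies in the span of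
  \<open>p\<^sub>i\<^sub>-\<^sub>1\<close> and \<open>p\<^sub>i\<close>; the argument for the \<open>p\<^sub>j\<close> is symmetric.
\<close>

lemma gkl_orthonormal:
  assumes gkl: "gkl_bidiagonalization A g l q p \<alpha> \<beta>" and "g \<noteq> 0"
    and nh: "gkl_not_halted l \<alpha> \<beta>"
    and ij: "i \<in> {1..l}" "j \<in> {1..l}"
  shows "q i \<bullet> q j = (if i = j then 1 else 0)" and "p i \<bullet> p j = (if i = j then 1 else 0)"
proof -
  note rec = gkl_recurrence[OF gkl]
  have \<beta>0: "\<beta> 0 = 0" using gkl by (simp add: gkl_bidiagonalization_def)
  have \<alpha>: "\<alpha> j \<noteq> 0" if "j \<in> {1..l}" for j
    using nh that by (simp add: gkl_not_halted_def)
  have \<beta>: "\<beta> j \<noteq> 0" if "j \<in> {1..<l}" for j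
    using nh that by (simp add: gkl_not_halted_def)
  have pn: "p j \<bullet> p j = 1" if "j \<in> {1..l}" for j
    using rec(3)[OF that \<alpha>[OF that]] by (simp add: norm_eq_1)
  have qn: "q j \<bullet> q j = 1" if "j \<in> {1..l}" for j
  proof (cases "j = 1")
    case True
    then have "norm (q j) = 1"
      using gkl \<open>g \<noteq> 0\<close> by (simp add: gkl_bidiagonalization_def)
    then show ?thesis by (simp add: norm_eq_1)
  next
    case False
    then have j: "j - 1 \<in> {1..l}" "j - 1 \<in> {1..<l}" "j - 1 + 1 = j" using that by auto
    show ?thesis
      using rec(4)[OF j(1) \<beta>[OF j(2)]] j(3) by (simp add: norm_eq_1)
  qed
  \<comment> \<open>The new \<open>q\<close> is handled first, as its orthogonality is used for that of the new \<open>p\<close>.\<close>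
  have orth: "\<forall>i j. 1 \<le> i \<and> i < j \<and> j \<le> k \<longrightarrow> q j \<bullet> q i = 0 \<and> p j \<bullet> p i = 0" if "k \<le> l" for k
    using that
  proof (induction k)
    case (Suc k)
    then have IHq: "q j \<bullet> q i = 0" and IHp: "p j \<bullet> p i = 0" if "1 \<le> i" "i < j" "j \<le> k" for i j
      using that by auto
    have qq: "q (Suc k) \<bullet> q i = 0" if i: "1 \<le> i" "i \<le> k" for i
    proof -
      have il: "i \<in> {1..l}" and kl: "k \<in> {1..l}" and kl': "k \<in> {1..<l}"
        using i Suc.prems by auto
      have "\<beta> k * (q (Suc k) \<bullet> q i) = (transpose A *v p k) \<bullet> q i - \<alpha> k * (q k \<bullet> q i)"
        unfolding rec(2)[OF kl] by (simp add: inner_add_left)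
      also have "(transpose A *v p k) \<bullet> q i = p k \<bullet> (A *v q i)"
        by (rule inner_matrix_transpose[symmetric])
      also have "\<dots> = \<beta> (i - 1) * (p k \<bullet> p (i - 1)) + \<alpha> i * (p k \<bullet> p i)"
        unfolding rec(1)[OF il] by (simp add: inner_add_right)
      also have "\<beta> (i - 1) * (p k \<bullet> p (i - 1)) = 0"
        using i IHp[of "i - 1" k] \<beta>0 by (cases "i = 1") auto
      also have "0 + \<alpha> i * (p k \<bullet> p i) - \<alpha> k * (q k \<bullet> q i) = 0"
        using i IHp[of i k] IHq[of i k] pn[OF kl] qn[OF kl] by (cases "i = k") auto
      finally show ?thesis using \<beta>[OF kl'] by simp
    qed
    have pp: "p (Suc k) \<bullet> p i = 0" if i: "1 \<le> i" "i \<le> k" for i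
    proof -
      have il: "i \<in> {1..l}" and kl: "k \<in> {1..l}" and sl: "Suc k \<in> {1..l}"
        using i Suc.prems by auto
      have "\<alpha> (Suc k) * (p (Suc k) \<bullet> p i) = p i \<bullet> (A *v q (Suc k)) - \<beta> k * (p k \<bullet> p i)"
        unfolding rec(1)[OF sl] by (simp add: inner_add_right inner_commute)
      also have "p i \<bullet> (A *v q (Suc k)) = (transpose A *v p i) \<bullet> q (Suc k)"
        by (rule inner_matrix_transpose)
      also have "\<dots> = \<alpha> i * (q (Suc k) \<bullet> q i) + \<beta> i * (q (Suc k) \<bullet> q (Suc i))"
        unfolding rec(2)[OF il]
        by (simp add: inner_add_left inner_commute[of "q (Suc k)" "q i"] inner_commute[of "q (Suc k)" "q (Suc i)"])
      also have "\<dots> - \<beta> k * (p k \<bullet> p i) = 0"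
        using i qq[of i] qq[of "Suc i"] IHp[of i k] pn[OF kl] qn[OF sl] by (cases "i = k") auto
      finally show ?thesis using \<alpha>[OF sl] by simp
    qed
    show ?case
      using qq pp IHq IHp by (auto simp: le_Suc_eq)
  qed simp
  show "q i \<bullet> q j = (if i = j then 1 else 0)" "p i \<bullet> p j = (if i = j then 1 else 0)"
    using orth[of l] ij qn[OF ij(1)] pn[OF ij(1)]
    by (cases i j rule: linorder_cases; force simp: inner_commute)+
qed

lemma index_pos_bij: "bij_betw (index_pos :: 'l::{finite,linorder} \<Rightarrow> nat) UNIV {1..CARD('l)}"
proof -
  have mono: "index_pos i < index_pos j" if "i < j" for i j :: 'l
    unfolding index_pos_def by (rule psubset_card_mono) (use that in auto)
  have inj: "inj (index_pos :: 'l \<Rightarrow> nat)"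
    by (rule linorder_injI) (use mono in fastforce)
  moreover have "range (index_pos :: 'l \<Rightarrow> nat) = {1..CARD('l)}"
  proof (rule card_subset_eq)
    show "range (index_pos :: 'l \<Rightarrow> nat) \<subseteq> {1..CARD('l)}"
    proof (clarsimp simp: index_pos_def)
      fix i :: 'l
      have "card {..i} \<noteq> 0" by (simp add: card_eq_0_iff)
      moreover have "card {..i} \<le> CARD('l)" by (rule card_mono) auto
      ultimately show "Suc 0 \<le> card {..i} \<and> card {..i} \<le> CARD('l)" by linarith
    qed
    show "card (range (index_pos :: 'l \<Rightarrow> nat)) = card {1..CARD('l)}"
      using card_image[OF inj] by simp
  qed simp
  ultimately show ?thesis by (simp add: bij_betw_def)
qed

lemma index_pos_mem: "index_pos (i :: 'l::{finite,linorder}) \<in> {1..CARD('l)}"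
  using index_pos_bij[where 'l='l] by (auto simp: bij_betw_def)

lemma gkl_Q_orthonormal:
  fixes Q :: "real^('l::{finite,linorder})^'n"
  assumes Q: "Q = gkl_Q q"
    and q: "\<And>i j. i \<in> {1..CARD('l)} \<Longrightarrow> j \<in> {1..CARD('l)} \<Longrightarrow> q i \<bullet> q j = (if i = j then 1 else 0)"
  shows "transpose Q ** Q = mat 1"
proof -
  have col: "column i Q = q (index_pos i)" for i
    by (simp add: column_def Q gkl_Q_def vec_eq_iff)
  have inj: "index_pos i = index_pos j \<longleftrightarrow> i = j" for i j :: 'l
    using index_pos_bij[where 'l='l] by (auto simp: bij_betw_def inj_eq)
  show ?thesis
    unfolding matrix_mult_transpose_dot_column col
    by (simp add: vec_eq_iff mat_def q[OF index_pos_mem index_pos_mem] inj)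
qed

text \<open>The recurrence for \<open>A q\<^sub>j\<close> in matrix form, \<open>A Q = P T\<close>, where \<open>P\<close> has the columns \<open>p\<^sub>1, \<dots>, p\<^sub>l\<close>.\<close>

lemma gkl_matrix_recurrence:
  fixes A :: "real^'n^'m" and Q :: "real^('l::{finite,linorder})^'n"
    and P :: "real^('l::{finite,linorder})^'m"
  assumes gkl: "gkl_bidiagonalization A g CARD('l) q p \<alpha> \<beta>"
    and Q: "Q = gkl_Q q" and P: "P = gkl_Q p" and T: "T = gkl_T \<alpha> \<beta>"
  shows "A ** Q = P ** T"
proof -
  have "(A ** Q) $ r $ c = (P ** T) $ r $ c" for r c
  proof -
    let ?L = "{1..CARD('l)}"
    let ?j = "index_pos c"
    let ?t = "\<lambda>i. if ?j = i then \<alpha> i else if ?j = i + 1 then \<beta> i else 0"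
    have j: "?j \<in> ?L" by (rule index_pos_mem)
    have \<beta>0: "\<beta> 0 = 0" using gkl by (simp add: gkl_bidiagonalization_def)
    have "(P ** T) $ r $ c = (\<Sum>k\<in>UNIV. p (index_pos (k::'l)) $ r * ?t (index_pos k))"
      by (simp add: matrix_matrix_mult_def P T gkl_Q_def gkl_T_def)
    also have "\<dots> = (\<Sum>i\<in>?L. p i $ r * ?t i)"
      by (rule sum.reindex_bij_betw[OF index_pos_bij])
    also have "\<dots> = (\<Sum>i\<in>?L. (if i = ?j then \<alpha> ?j * p ?j $ r else 0)
        + (if i = ?j - 1 then \<beta> (?j - 1) * p (?j - 1) $ r else 0))"
      using j by (intro sum.cong) auto
    \<comment> \<open>For the first column \<open>?j - 1 = 0\<close> lies outside the range of summation, but \<open>\<beta> 0 = 0\<close>.\<close>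
    also have "\<dots> = \<alpha> ?j * p ?j $ r + \<beta> (?j - 1) * p (?j - 1) $ r"
      using j \<beta>0 by (cases "?j = 1") (auto simp: sum.distrib)
    also have "\<dots> = (A *v q ?j) $ r"
      unfolding gkl_recurrence(1)[OF gkl j] by simp
    also have "\<dots> = (A ** Q) $ r $ c"
      by (simp add: matrix_vector_mult_def matrix_matrix_mult_def Q gkl_Q_def)
    finally show ?thesis by simp
  qed
  then show ?thesis by (simp add: vec_eq_iff)
qed

lemma gkl_gram_projection:
  fixes A :: "real^'n^'m" and Q :: "real^'l^'n" and P :: "real^'l^'m"
  assumes AQ: "A ** Q = P ** T" and P: "transpose P ** P = mat 1"
  shows "transpose Q ** (transpose A ** A) ** Q = transpose T ** T"
proof -
  have "transpose Q ** (transpose A ** A) ** Q = transpose (A ** Q) ** (A ** Q)"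
    by (simp add: matrix_transpose_mul matrix_mul_assoc)
  also have "\<dots> = transpose T ** (transpose P ** P) ** T"
    unfolding AQ by (simp add: matrix_transpose_mul matrix_mul_assoc)
  finally show ?thesis by (simp add: P)
qed

section \<open>The regularized step\<close>

lemma step_w_equation:
  fixes Q :: "real^'l^'n" and T :: "real^'l^'l"
  assumes "lam > 0"
  shows "((transpose T ** T) ** (transpose T ** T) + lam *\<^sub>R mat 1) *v step_w Q T g lam
    = - (matrix_sqrt (transpose T ** T) *v (transpose Q *v g))"
proof -
  define M where "M = transpose T ** T"
  let ?K = "M ** M + lam *\<^sub>R mat 1"
  have sym: "transpose M = M" by (simp add: M_def matrix_transpose_mul)
  have Kv: "?K *v x = M *v (M *v x) + lam *\<^sub>R x" for x
    by (simp add: matrix_vector_mult_add_rdistrib matrix_vector_mul_assoc scaleR_matrix_vector_assoc[symmetric])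
  have "x = 0" if "?K *v x = 0" for x
  proof -
    have "x \<bullet> (M *v (M *v x)) + lam * (x \<bullet> x) = 0"
      using that by (metis Kv inner_add_right inner_scaleR_right inner_zero_right)
    moreover have "x \<bullet> (M *v (M *v x)) = (M *v x) \<bullet> (M *v x)"
      by (simp add: inner_matrix_transpose[of x M] sym)
    moreover have "0 \<le> (M *v x) \<bullet> (M *v x)" "0 \<le> lam * (x \<bullet> x)"
      using assms by simp_all
    ultimately have "lam * (x \<bullet> x) = 0" by linarith
    then show ?thesis using assms by simp
  qed
  then have inj: "inj ((*v) ?K)"
    by (simp add: linear_injective_0[OF matrix_vector_mul_linear])
  then have "surj ((*v) ?K)"
    by (rule linear_injective_imp_surjective[OF matrix_vector_mul_linear]) simp
  then have "\<exists>!w. ?K *v w = b" for b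
    using inj by (metis injD surjD)
  then show ?thesis
    unfolding step_w_def M_def[symmetric] by (rule theI')
qed

text \<open>
  Multiplying the equation for \<open>w\<close> by the square root shows that the residual of the projected
  model, multiplied by \<open>T\<^sup>T T\<close>, is parallel to the coordinates of the step.
\<close>

lemma regularized_step_residual:
  fixes Q :: "real^'l^'n" and T :: "real^'l^'l"
  assumes lam: "lam > 0" and QQ: "transpose Q ** Q = mat 1"
  obtains u where "step_p Q T g lam = Q *v u"
    "(transpose T ** T) *v ((transpose T ** T) *v u + transpose Q *v g) = - (lam *\<^sub>R u)"
proof -
  define M where "M = transpose T ** T"
  define S where "S = matrix_sqrt M"
  define w where "w = step_w Q T g lam"
  define u where "u = S *v w"
  have SS: "S *v (S *v x) = M *v x" for x
    using matrix_sqrt_properties(2)[OF psd_matrix_gram, of T]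
    by (simp add: S_def M_def matrix_vector_mul_assoc)
  have "transpose Q *v (Q *v x) = x" for x
    by (simp add: matrix_vector_mul_assoc QQ)
  then have p: "step_p Q T g lam = Q *v u"
    by (simp add: step_p_def step_z_def u_def S_def w_def M_def matrix_vector_mul_assoc[symmetric])
  have "M *v (M *v w) + lam *\<^sub>R w = - (S *v (transpose Q *v g))"
    using step_w_equation[OF lam, of T Q g]
    by (simp add: M_def[symmetric] S_def w_def matrix_vector_mult_add_rdistrib
        matrix_vector_mul_assoc[symmetric] scaleR_matrix_vector_assoc[symmetric])
  then have "S *v (M *v (M *v w) + lam *\<^sub>R w) = S *v (- (S *v (transpose Q *v g)))"
    by simp
  then have "S *v (M *v (M *v w)) + lam *\<^sub>R u = - (M *v (transpose Q *v g))"
    by (simp add: matrix_vector_right_distrib matrix_vector_mult_scaleR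
        linear_neg[OF matrix_vector_mul_linear] SS u_def)
  moreover have "S *v (M *v (M *v w)) = M *v (M *v u)"
    by (simp add: SS[symmetric] u_def)
  ultimately have "M *v (M *v u + transpose Q *v g) = - (lam *\<^sub>R u)"
    by (simp add: matrix_vector_right_distrib algebra_simps eq_neg_iff_add_eq_0)
  with p that show ?thesis by (simp add: M_def)
qed

text \<open>
  The estimate rests only on \<open>Q\<close> having orthonormal columns and on \<open>T\<^sup>T T\<close> being the projection of
  \<open>B\<close> onto their span.
\<close>

lemma regularized_step_error_decrease:
  fixes Q :: "real^'l^'n" and T :: "real^'l^'l" and B :: "real^'n^'n" and g e :: "real^'n" and lam :: real
  defines "pk \<equiv> step_p Q T g lam"
  assumes lam: "lam > 0" and QQ: "transpose Q ** Q = mat 1"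
    and QBQ: "transpose Q ** B ** Q = transpose T ** T"
    and e: "norm (transpose Q *v (B *v e + g)) \<le> c * norm (transpose Q *v (B *v pk + g))"
  shows "(norm (pk - e))^2 - (norm e)^2 \<le>
    (2 / lam) * (c - 1) * (norm (transpose Q *v (B *v pk + g)))^2
    + (2 / lam) * norm (transpose Q *v (B *v pk + g))
      * matrix_norm2 (Q ** transpose T ** T ** transpose Q - Q ** transpose Q ** B) * norm e"
proof -
  define M where "M = transpose T ** T"
  define E where "E = Q ** transpose T ** T ** transpose Q - Q ** transpose Q ** B"
  define r where "r = transpose Q *v (B *v pk + g)"
  define d where "d = transpose Q *v (B *v e + g)"
  obtain u where p: "pk = Q *v u"
    and Mu: "M *v (M *v u + transpose Q *v g) = - (lam *\<^sub>R u)"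
    using regularized_step_residual[OF lam QQ] unfolding pk_def M_def by blast
  have sym: "transpose M = M" by (simp add: M_def matrix_transpose_mul)
  have QQv: "transpose Q *v (Q *v x) = x" for x
    by (simp add: matrix_vector_mul_assoc QQ)
  have iso: "(Q *v x) \<bullet> (Q *v x) = x \<bullet> x" for x
    by (simp add: inner_matrix_transpose[of "Q *v x" Q] QQv)
  have r: "r = M *v u + transpose Q *v g"
    using QBQ by (simp add: r_def p M_def matrix_vector_right_distrib matrix_vector_mul_assoc matrix_mul_assoc)
  have Mr: "M *v r = - (lam *\<^sub>R u)" using Mu by (simp add: r)
  have E_v: "E *v e = Q *v (M *v (transpose Q *v e)) - Q *v (transpose Q *v (B *v e))"
    by (simp add: E_def M_def matrix_vector_mult_diff_rdistrib matrix_vector_mul_assoc matrix_mul_assoc)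
  have split: "M *v (transpose Q *v e) = transpose Q *v (E *v e) + d - r + M *v u"
    by (simp add: E_v d_def r matrix_vector_right_distrib matrix_vector_mult_diff_distrib QQv)
  have rMu: "r \<bullet> (M *v u) = - (lam * (u \<bullet> u))"
    by (simp add: inner_matrix_transpose[of r M] sym Mr)
  have "lam * (pk \<bullet> e) = (lam *\<^sub>R u) \<bullet> (transpose Q *v e)"
    by (simp add: p inner_matrix_transpose[of u "transpose Q"])
  also have "\<dots> = - (r \<bullet> (M *v (transpose Q *v e)))"
    by (simp add: inner_matrix_transpose[of r M] sym Mr)
  also have "\<dots> = - ((Q *v r) \<bullet> (E *v e) + r \<bullet> d - r \<bullet> r - lam * (u \<bullet> u))"
    unfolding split
    by (simp add: inner_add_right inner_diff_right rMu inner_matrix_transpose[of r "transpose Q"])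
  finally have pe: "lam * (pk \<bullet> e) = - ((Q *v r) \<bullet> (E *v e) + r \<bullet> d - r \<bullet> r - lam * (u \<bullet> u))" .
  have "(norm (pk - e))^2 - (norm e)^2 = u \<bullet> u - 2 * (pk \<bullet> e)"
    by (simp add: power2_norm_eq_inner inner_diff_left inner_diff_right inner_commute p iso)
  also have "\<dots> = (2 / lam) * ((Q *v r) \<bullet> (E *v e) + r \<bullet> d - r \<bullet> r) - u \<bullet> u"
    using pe lam by (simp add: field_simps)
  also have "\<dots> \<le> (2 / lam) * ((Q *v r) \<bullet> (E *v e) + r \<bullet> d - r \<bullet> r)" by simp
  also have "\<dots> \<le> (2 / lam) * (norm r * (matrix_norm2 E * norm e) + c * (norm r)^2 - (norm r)^2)"
  proof -
    have "norm (Q *v r) = norm r" by (simp add: norm_eq_sqrt_inner iso)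
    then have "(Q *v r) \<bullet> (E *v e) \<le> norm r * norm (E *v e)"
      using norm_cauchy_schwarz[of "Q *v r" "E *v e"] by simp
    also have "\<dots> \<le> norm r * (matrix_norm2 E * norm e)"
      unfolding matrix_norm2_def
      by (intro mult_left_mono onorm matrix_vector_mul_bounded_linear) simp
    finally have 1: "(Q *v r) \<bullet> (E *v e) \<le> norm r * (matrix_norm2 E * norm e)" .
    have "r \<bullet> d \<le> norm r * norm d" by (rule norm_cauchy_schwarz)
    also have "\<dots> \<le> norm r * (c * norm r)"
      using e by (intro mult_left_mono) (simp_all add: d_def r_def)
    finally have 2: "r \<bullet> d \<le> c * (norm r)^2" by (simp add: power2_eq_square mult_ac)
    have 3: "r \<bullet> r = (norm r)^2" by (simp add: power2_norm_eq_inner)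
    show ?thesis
      by (rule mult_left_mono) (use 1 2 3 lam in auto)
  qed
  also have "\<dots> = (2 / lam) * (c - 1) * (norm r)^2 + (2 / lam) * norm r * matrix_norm2 E * norm e"
    by (simp add: algebra_simps diff_divide_distrib)
  finally show ?thesis unfolding r_def E_def .
qed

section \<open>Decrease of the iteration error\<close>

theorem lemma6p2:
  fixes F :: "real^'n \<Rightarrow> real^'m" and D :: "(real^'n) set"
    and J :: "real^'n \<Rightarrow> real^'n^'m"
    and y y\<^sub>\<delta> :: "real^'m" and \<delta> :: real
    and xk xk1 xdag gk ek pk :: "real^'n"
    and Bk :: "real^'n^'n" and mk :: "real^'n \<Rightarrow> real^'n"
    and q :: "nat \<Rightarrow> real^'n" and p :: "nat \<Rightarrow> real^'m" and \<alpha> \<beta> :: "nat \<Rightarrow> real"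
    and Q :: "real^('l::{finite,linorder})^'n" and T :: "real^('l::{finite,linorder})^('l::{finite,linorder})"
    and \<Delta>k lamk \<theta>k :: real
  assumes dims: "CARD('n) \<le> CARD('m)" "CARD('l) \<le> CARD('n)"
    and F_deriv: "\<And>x. x \<in> D \<Longrightarrow> (F has_derivative (\<lambda>h. J x *v h)) (at x within D)"
    and J_cont: "continuous_on D J"
    and noise: "\<delta> \<ge> 0" "norm (y - y\<^sub>\<delta>) \<le> \<delta>"
    and xk: "xk \<in> D"
    and Bk: "Bk = transpose (J xk) ** J xk"
    and gk: "gk = transpose (J xk) *v (F xk - y\<^sub>\<delta>)" "gk \<noteq> 0"
    and mk: "\<And>v. mk v = Bk *v v + gk"
    and gkl: "gkl_bidiagonalization (J xk) gk CARD('l) q p \<alpha> \<beta>"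
    and not_halted: "gkl_not_halted CARD('l) \<alpha> \<beta>"
    and Q: "Q = gkl_Q q"
    and T: "T = gkl_T \<alpha> \<beta>"
    and trust_region: "\<Delta>k > 0" "norm (step_w Q T gk lamk) \<le> \<Delta>k"
      "lamk * (\<Delta>k - norm (step_w Q T gk lamk)) = 0"
    and lamk: "lamk > 0"
    and pk: "pk = step_p Q T gk lamk"
    and xdag: "xdag \<in> D"
      "\<And>x. x \<in> D \<Longrightarrow> (1/2) * (norm (F xdag - y))^2 \<le> (1/2) * (norm (F x - y))^2"
    and ek: "ek = xdag - xk"
    and xk1: "xk1 = xk + pk"
    and \<theta>k: "\<theta>k > 1"
      "norm (transpose Q *v mk ek) \<le> (1 / \<theta>k) * norm (transpose Q *v mk pk)"
  shows "(norm (xk1 - xdag))^2 - (norm (xk - xdag))^2 \<le>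
    (2 / lamk) * (1 / \<theta>k - 1) * (norm (transpose Q *v mk pk))^2
    + (2 / lamk) * norm (transpose Q *v mk pk)
      * matrix_norm2 (Q ** transpose T ** T ** transpose Q - Q ** transpose Q ** Bk)
      * norm (xk - xdag)"
proof -
  define P where "P = (gkl_Q p :: real^('l::{finite,linorder})^'m)"
  have QQ: "transpose Q ** Q = mat 1"
    by (rule gkl_Q_orthonormal[OF Q]) (rule gkl_orthonormal(1)[OF gkl gk(2) not_halted])
  have "transpose P ** P = mat 1"
    by (rule gkl_Q_orthonormal[OF P_def]) (rule gkl_orthonormal(2)[OF gkl gk(2) not_halted])
  then have QBQ: "transpose Q ** Bk ** Q = transpose T ** T"
    unfolding Bk by (rule gkl_gram_projection[OF gkl_matrix_recurrence[OF gkl Q P_def T]])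
  have "norm (transpose Q *v (Bk *v ek + gk))
      \<le> (1 / \<theta>k) * norm (transpose Q *v (Bk *v step_p Q T gk lamk + gk))"
    using \<theta>k(2) by (simp add: mk pk)
  from regularized_step_error_decrease[OF lamk QQ QBQ this]
  have "(norm (pk - ek))^2 - (norm ek)^2 \<le>
    (2 / lamk) * (1 / \<theta>k - 1) * (norm (transpose Q *v mk pk))^2
    + (2 / lamk) * norm (transpose Q *v mk pk)
      * matrix_norm2 (Q ** transpose T ** T ** transpose Q - Q ** transpose Q ** Bk) * norm ek"
    by (simp only: mk pk)
  moreover have "pk - ek = xk1 - xdag" by (simp add: ek xk1)
  moreover have "norm ek = norm (xk - xdag)" by (simp add: ek norm_minus_commute)
  ultimately show ?thesis by simp
qed

end
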